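(* Let $l\geq 0$ be an integer and let $B$ be a balanced bipartite digraph with partite sets $X=\{x_1,x_2,\ldots,x_a\}$ and $Y=\{y_1,y_2,\ldots,y_a\}$ and arc set $A(B)$, such that $d^+(u)+d^-(v)\geq a+l$ for all vertices $u$ and $v$ from different partite sets with $uv\notin A(B)$. Suppose that $C=x_1y_1x_2y_2\ldots x_ay_ax_1$ is a Hamiltonian cycle of $B$, and let $k\geq 1$ be the minimum integer for which there exists an index $i$ such that $y_{i+k-1}x_i\in A(B)$ or $x_{i+k}y_i\in A(B)$ (subscripts taken modulo $a$). If $B$ has no Hamiltonian bypass, then $l=0$ and $k=2$.
   Context: All digraphs are finite, without loops and without multiple arcs; opposite arcs $xy$ and $yx$ may both be present. The arc from $x$ to $y$ is denoted $xy$, and if it is present one says that $x$ dominates $y$. The out-degree $d^+(x)$ is the number of vertices $y$ such that $xy$ is an arc, and the in-degree $d^-(x)$ is the number of vertices $y$ such that $yx$ is an arc. A balanced bipartite digraph is a digraph whose vertex set is partitioned into two partite sets of equal cardinality such that every arc joins vertices from different partite sets (in either direction). Paths and cycles are simple and directed; a Hamiltonian cycle is a cycle passing through all vertices. A Hamiltonian bypass in a digraph of order $n$ is a path $w_1w_2\ldots w_n$ passing through all vertices whose initial vertex dominates its terminal vertex, i.e. such that $w_1w_n$ is an arc. *)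

theory Defs
  imports "Graph_Theory.Graph_Theory"
begin

locale balanced_bipartite_digraph = digraph G
  for G :: "('v, 'e) pre_digraph" (structure) +
  fixes X Y :: "'v set"
  assumes verts_eq: "verts G = X \<union> Y"
    and disjoint: "X \<inter> Y = {}"
    and balanced: "card X = card Y"
    and arcs_cross: "u \<rightarrow> v \<Longrightarrow> u \<in> X \<and> v \<in> Y \<or> u \<in> Y \<and> v \<in> X"

context pre_digraph
begin

text \<open>
  A Hamiltonian cycle is described by its closed vertex sequence, in which the initial vertex is
  repeated at the end. The underlying arc sequence is irrelevant in the absence of multiple arcs.
\<close>

definition hamiltonian_cycle :: "'a list \<Rightarrow> bool" where
  "hamiltonian_cycle c \<longleftrightarrow> (\<exists>u p. cycle p \<and> awalk_verts u p = c \<and> set c = verts G)"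

definition hamiltonian_bypass :: "'a list \<Rightarrow> bool" where
  "hamiltonian_bypass w \<longleftrightarrow> vpath w G \<and> set w = verts G \<and> hd w \<rightarrow> last w"

end

text \<open>
  The indices are shifted to start at 0: for \<open>i < a\<close>, the values \<open>x i\<close> and \<open>y i\<close> stand for
  $x_{i+1}$ and $y_{i+1}$. Since the condition below only involves differences of indices modulo
  \<open>a\<close>, the shift does not affect it.
\<close>

definition alternating_seq :: "nat \<Rightarrow> (nat \<Rightarrow> 'v) \<Rightarrow> (nat \<Rightarrow> 'v) \<Rightarrow> 'v list" where
  "alternating_seq a x y = concat (map (\<lambda>i. [x i, y i]) [0..<a]) @ [x 0]"

definition has_back_arc ::
  "('v, 'e) pre_digraph \<Rightarrow> nat \<Rightarrow> (nat \<Rightarrow> 'v) \<Rightarrow> (nat \<Rightarrow> 'v) \<Rightarrow> nat \<Rightarrow> bool" where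
  "has_back_arc G a x y k \<longleftrightarrow>
    (\<exists>i<a. y ((i + k - 1) mod a) \<rightarrow>\<^bsub>G\<^esub> x i \<or> x ((i + k) mod a) \<rightarrow>\<^bsub>G\<^esub> y i)"

end

theory Submission
  imports Defs
begin

text \<open>
  Write the Hamiltonian cycle as \<open>z 0, z 1, \<dots>, z (2 * a - 1)\<close>, alternating between the two partite
  sets. An arc from \<open>y\<close> at index $i+k-1$ to \<open>x\<close> at index $i$, or from \<open>x\<close> at index $i+k$ to \<open>y\<close> at
  index $i$, is in both cases an arc that jumps back by \<open>2 * k - 1\<close> positions along the cycle. So
  the two kinds need no separate treatment, and after a rotation the shortest such arc is
  \<open>z (2 * k - 1) \<rightarrow> z 0\<close>. It leads from the first to the last vertex of the path
  that follows the cycle from \<open>z (2 * k - 1)\<close> round to \<open>z 0\<close>, and the only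
  vertices which that path misses are those of the segment \<open>z 1, \<dots>, z (2 * k - 2)\<close>.

  If \<open>k = 1\<close>, the segment is empty and the path from \<open>z 1\<close> round to \<open>z 0\<close> is a Hamiltonian bypass
  (lemma \<open>bypass_if_reversed_cycle_arc\<close>). If \<open>k \<ge> 2\<close>, a bypass arises as soon as the segment can
  be inserted between consecutive vertices \<open>z j\<close> and \<open>z (Suc j)\<close> of the path from \<open>z (2 * k - 1)\<close>
  to \<open>z 0\<close>, that is, as soon as \<open>z j \<rightarrow> z 1\<close> and \<open>z (2 * k - 2) \<rightarrow> z (Suc j)\<close> (lemma
  \<open>bypass_if_insertible_segment\<close>). Only even \<open>j\<close> with \<open>2 * k \<le> j \<le> 2 * a - 2\<close> matter, which are
  \<open>a - k\<close> places. By the minimality of \<open>k\<close>, no arc from the last vertex of the segment and no arc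
  into its first vertex has both ends in the segment. Hence all arcs out of \<open>z (2 * k - 2)\<close>
  except the one to \<open>z (2 * k - 1)\<close>, and all arcs into \<open>z 1\<close> except the one from \<open>z 0\<close>, belong
  to these places. In the absence of a bypass no place is used twice, so the out-degree of
  \<open>z (2 * k - 2)\<close> and the in-degree of \<open>z 1\<close> add up to at most \<open>a - k + 2\<close> (lemma
  \<open>degree_sum_le\<close>). Minimality also says that \<open>z (2 * k - 2)\<close> does not dominate \<open>z 1\<close>, so the same
  sum is at least \<open>a + l\<close>. Therefore \<open>k + l \<le> 2\<close>, which leaves only \<open>k = 2\<close> and \<open>l = 0\<close>.
\<close>

section \<open>Degrees and walks in digraphs\<close>

context digraph
begin

lemma out_degree_eq_card_successors: "out_degree G u = card {w. u \<rightarrow> w}"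
proof -
  have "inj_on (head G) (out_arcs G u)"
    by (rule inj_onI) (auto simp: in_out_arcs_conv arc_to_ends_def intro: no_multi_arcs)
  moreover have "head G ` out_arcs G u = {w. u \<rightarrow> w}"
    by (auto simp: arcs_ends_def arc_to_ends_def)
  ultimately show ?thesis
    unfolding out_degree_def by (metis card_image)
qed

lemma in_degree_eq_card_predecessors: "in_degree G u = card {w. w \<rightarrow> u}"
proof -
  have "inj_on (tail G) (in_arcs G u)"
    by (rule inj_onI) (auto simp: in_in_arcs_conv arc_to_ends_def intro: no_multi_arcs)
  moreover have "tail G ` in_arcs G u = {w. w \<rightarrow> u}"
    by (force simp: arcs_ends_def arc_to_ends_def)
  ultimately show ?thesis
    unfolding in_degree_def by (metis card_image)
qed

lemma vwalk_arcs_awalk_verts: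
  "awalk u p v \<Longrightarrow> set (vwalk_arcs (awalk_verts u p)) \<subseteq> arcs_ends G"
proof (induction p arbitrary: u)
  case (Cons e p)
  then have "e \<in> arcs G" "tail G e = u" "awalk (head G e) p v"
    by (auto simp: awalk_Cons_iff)
  moreover have "awalk_verts (head G e) p \<noteq> []" "hd (awalk_verts (head G e) p) = head G e"
    using \<open>awalk (head G e) p v\<close> by auto
  ultimately show ?case
    using Cons.IH by (auto simp: arcs_ends_def arc_to_ends_def)
qed simp

end

lemma nth_consecutive_in_vwalk_arcs:
  "Suc i < length p \<Longrightarrow> (p ! i, p ! Suc i) \<in> set (vwalk_arcs p)"
proof (induction p arbitrary: i rule: vwalk_arcs.induct)
  case (3 x y xs)
  then show ?case by (cases i) auto
qed auto

lemma vwalk_arcs_map_upt: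
  assumes "\<And>m. i \<le> m \<Longrightarrow> Suc m < j \<Longrightarrow> (z m, z (Suc m)) \<in> A"
  shows "set (vwalk_arcs (map z [i..<j])) \<subseteq> A"
  using assms
proof (induction j)
  case (Suc j)
  show ?case
  proof (cases "i < j")
    case True
    then obtain j' where "j = Suc j'" "i \<le> j'"
      by (cases j) auto
    with Suc show ?thesis
      using set_vwalk_arcs_snoc[of "map z [i..<j]" "z j"] by auto
  qed (cases "i = j"; simp)
qed simp

section \<open>A Hamiltonian cycle with a back arc\<close>

locale numbered_hamiltonian_cycle = digraph G
  for G :: "('v, 'e) pre_digraph" (structure) +
  fixes z :: "nat \<Rightarrow> 'v" and N :: nat
  assumes inj: "inj_on z {..<N}"
    and covers: "z ` {..<N} = verts G"
    and step: "Suc m < N \<Longrightarrow> z m \<rightarrow> z (Suc m)"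
    and close: "z (N - 1) \<rightarrow> z 0"
begin

text \<open>The bypass is the cycle with the arc \<open>z 0 \<rightarrow> z 1\<close> removed.\<close>

lemma bypass_if_reversed_cycle_arc:
  assumes "1 < N" "z 1 \<rightarrow> z 0"
  shows "\<exists>w. hamiltonian_bypass w"
proof -
  let ?q = "[1..<N] @ [0]"
  have q: "set ?q = {..<N}" "distinct ?q"
    using assms by auto
  have "set (vwalk_arcs (map z [1..<N])) \<subseteq> arcs_ends G"
    by (rule vwalk_arcs_map_upt) (rule step)
  moreover have "last (map z [1..<N]) = z (N - 1)"
    using assms by (simp add: last_map)
  ultimately have "set (vwalk_arcs (map z ?q)) \<subseteq> arcs_ends G"
    using assms close by (simp add: vwalk_arcs_append)
  moreover have "set (map z ?q) = verts G"
    using q covers by (metis set_map)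
  moreover have "distinct (map z ?q)"
    using q inj by (metis distinct_map)
  moreover have "hd (map z ?q) = z 1" "last (map z ?q) = z 0"
    using assms by (auto simp: hd_append hd_map)
  ultimately have "hamiltonian_bypass (map z ?q)"
    using assms unfolding hamiltonian_bypass_def vpath_def vwalk_def by auto
  then show ?thesis ..
qed

text \<open>
  The bypass follows the cycle from \<open>z e\<close> to \<open>z j\<close>, makes a detour through the segment
  \<open>z 1, \<dots>, z (e - 1)\<close>, and resumes the cycle from \<open>z (Suc j)\<close> to \<open>z 0\<close>, which \<open>z e\<close> dominates.
\<close>

lemma bypass_if_insertible_segment:
  assumes e: "2 \<le> e" "e \<le> j" "Suc j < N"
    and back_arc: "z e \<rightarrow> z 0"
    and enter: "z j \<rightarrow> z 1" and leave: "z (e - 1) \<rightarrow> z (Suc j)"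
  shows "\<exists>w. hamiltonian_bypass w"
proof -
  let ?q = "[e..<Suc j] @ [1..<e] @ [Suc j..<N] @ [0]"
  have q: "set ?q = {..<N}" "distinct ?q"
    using e by auto
  have seg: "set (vwalk_arcs (map z [i..<k])) \<subseteq> arcs_ends G" if "k \<le> N" for i k
    by (rule vwalk_arcs_map_upt) (use that in \<open>auto intro: step\<close>)
  have ends: "hd (map z [i..<k]) = z i" "last (map z [i..<k]) = z (k - 1)" if "i < k" for i k
    using that by (auto simp: hd_map last_map)
  have 1: "set (vwalk_arcs (map z [Suc j..<N] @ [z 0])) \<subseteq> arcs_ends G"
    using e seg[of N "Suc j"] ends[of "Suc j" N] close by (simp add: vwalk_arcs_append)
  have 2: "set (vwalk_arcs (map z [1..<e] @ map z [Suc j..<N] @ [z 0])) \<subseteq> arcs_ends G"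
    using e seg[of e 1] ends[of 1 e] ends[of "Suc j" N] leave 1
    by (subst vwalk_arcs_append) (auto simp: hd_append simp del: upt_Suc)
  have "set (vwalk_arcs (map z [e..<Suc j] @ map z [1..<e] @ map z [Suc j..<N] @ [z 0]))
      \<subseteq> arcs_ends G"
    using e seg[of "Suc j" e] ends[of e "Suc j"] ends[of 1 e] enter 2
    by (subst vwalk_arcs_append) (auto simp: hd_append simp del: upt_Suc)
  then have "set (vwalk_arcs (map z ?q)) \<subseteq> arcs_ends G"
    by (simp del: upt_Suc)
  moreover have "set (map z ?q) = verts G"
    using q covers by (metis set_map)
  moreover have "distinct (map z ?q)"
    using q inj by (metis distinct_map)
  moreover have "hd (map z ?q) = z e" "last (map z ?q) = z 0"
    using e ends[of e "Suc j"] by (auto simp: hd_append simp del: upt_Suc)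
  ultimately have "hamiltonian_bypass (map z ?q)"
    using back_arc unfolding hamiltonian_bypass_def vpath_def vwalk_def by auto
  then show ?thesis ..
qed

text \<open>
  The index \<open>m\<close> with \<open>k \<le> m < a\<close> stands for the cycle arc from \<open>z (2 * m)\<close> to \<open>z (2 * m + 1)\<close>.
  If such an \<open>m\<close> satisfied both \<open>z (2 * m) \<rightarrow> z 1\<close> and \<open>z (2 * k - 2) \<rightarrow> z (2 * m + 1)\<close>, the segment
  \<open>z 1, \<dots>, z (2 * k - 2)\<close> could be inserted there. So each of the \<open>a - k\<close> indices contributes at
  most one to the sum of the two degrees. The only further contributions are the cycle arcs
  \<open>z (2 * k - 2) \<rightarrow> z (2 * k - 1)\<close> and \<open>z 0 \<rightarrow> z 1\<close>.
\<close>

lemma degree_sum_le: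
  assumes N: "N = 2 * a"
    and parity: "\<And>p q. p < N \<Longrightarrow> q < N \<Longrightarrow> z p \<rightarrow> z q \<Longrightarrow> odd (p + q)"
    and k: "2 \<le> k" "k \<le> a"
    and back_arc: "z (2 * k - 1) \<rightarrow> z 0"
    and short_out: "\<And>m. m < k - 1 \<Longrightarrow> \<not> z (2 * k - 2) \<rightarrow> z (2 * m + 1)"
    and short_in: "\<And>m. 1 \<le> m \<Longrightarrow> m < k \<Longrightarrow> \<not> z (2 * m) \<rightarrow> z 1"
    and no_bypass: "\<nexists>w. hamiltonian_bypass w"
  shows "out_degree G (z (2 * k - 2)) + in_degree G (z 1) + k \<le> a + 2"
proof -
  define S where "S = {m \<in> {k..<a}. z (2 * k - 2) \<rightarrow> z (2 * m + 1)}"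
  define T where "T = {m \<in> {k..<a}. z (2 * m) \<rightarrow> z 1}"
  have fin: "finite S" "finite T"
    by (auto simp: S_def T_def)
  have index: "\<exists>p<N. w = z p" if "w \<in> verts G" for w
    using that covers by auto
  have "w \<in> (\<lambda>m. z (2 * m + 1)) ` insert (k - 1) S" if w: "z (2 * k - 2) \<rightarrow> w" for w
  proof -
    obtain p where p: "p < N" "w = z p"
      using index w by (meson adj_in_verts)
    then have "odd p"
      using parity[of "2 * k - 2" p] w k N by auto
    then obtain m where m: "p = 2 * m + 1"
      by (elim oddE)
    with p w have "\<not> m < k - 1"
      using short_out by blast
    then have "m \<in> insert (k - 1) S"
      using p w m N by (auto simp: S_def)
    then show ?thesis
      using p m by blast
  qed
  then have "{w. z (2 * k - 2) \<rightarrow> w} \<subseteq> (\<lambda>m. z (2 * m + 1)) ` insert (k - 1) S"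
    by blast
  then have "out_degree G (z (2 * k - 2)) \<le> card (insert (k - 1) S)"
    unfolding out_degree_eq_card_successors using fin
    by (meson card_image_le card_mono finite_imageI finite_insert le_trans)
  then have out: "out_degree G (z (2 * k - 2)) \<le> Suc (card S)"
    using card_insert_le_m1[of "Suc (card S)" S "k - 1"] by simp
  have "w \<in> (\<lambda>m. z (2 * m)) ` insert 0 T" if w: "w \<rightarrow> z 1" for w
  proof -
    obtain p where p: "p < N" "w = z p"
      using index w by (meson adj_in_verts)
    then have "even p"
      using parity[of p 1] w k N by auto
    then obtain m where m: "p = 2 * m"
      by (elim evenE)
    with p w have "m = 0 \<or> \<not> m < k"
      using short_in[of m] by (cases m) auto
    then have "m \<in> insert 0 T"
      using p w m N by (auto simp: T_def)
    then show ?thesis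
      using p m by blast
  qed
  then have "{w. w \<rightarrow> z 1} \<subseteq> (\<lambda>m. z (2 * m)) ` insert 0 T"
    by blast
  then have "in_degree G (z 1) \<le> card (insert 0 T)"
    unfolding in_degree_eq_card_predecessors using fin
    by (meson card_image_le card_mono finite_imageI finite_insert le_trans)
  then have "in_degree G (z 1) \<le> Suc (card T)"
    using card_insert_le_m1[of "Suc (card T)" T 0] by simp
  moreover have "S \<inter> T = {}"
  proof (rule ccontr)
    assume "S \<inter> T \<noteq> {}"
    then obtain m where "m \<in> S" "m \<in> T"
      by blast
    then have "\<exists>w. hamiltonian_bypass w"
      using k N back_arc
      by (intro bypass_if_insertible_segment[of "2 * k - 1" "2 * m"])
        (auto simp: S_def T_def numeral_2_eq_2)
    with no_bypass show False
      by blast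
  qed
  then have "card S + card T = card (S \<union> T)"
    using fin by (simp add: card_Un_disjoint)
  moreover have "card (S \<union> T) \<le> card {k..<a}"
    by (rule card_mono) (auto simp: S_def T_def)
  ultimately show ?thesis
    using out k by simp
qed

end

section \<open>The cyclic numbering of the alternating cycle\<close>

definition interleave :: "(nat \<Rightarrow> 'v) \<Rightarrow> (nat \<Rightarrow> 'v) \<Rightarrow> nat \<Rightarrow> 'v" where
  "interleave x y m = (if even m then x (m div 2) else y (m div 2))"

lemma alternating_seq_eq_interleave:
  "alternating_seq a x y = map (interleave x y) [0..<2 * a] @ [interleave x y 0]"
proof -
  have "concat (map (\<lambda>i. [x i, y i]) [0..<a]) = map (interleave x y) [0..<2 * a]"
    by (induction a) (auto simp: interleave_def)
  then show ?thesis
    by (simp add: alternating_seq_def interleave_def)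
qed

lemma interleave_mod:
  "interleave x y (n mod (2 * a)) =
    (if even n then x (n div 2 mod a) else y (n div 2 mod a))"
proof -
  have "n mod (2 * a) = 2 * (n div 2 mod a) + n mod 2"
    by (rule mod_mult2_eq)
  then show ?thesis
    by (cases "even n") (auto simp: interleave_def even_iff_mod_2_eq_zero odd_iff_mod_2_eq_one)
qed

text \<open>
  In terms of positions on the cycle, the two kinds of back arcs become a single kind, a jump
  back by \<open>2 * k - 1\<close>: arcs into some \<open>x i\<close> end at even positions, arcs into some \<open>y i\<close> at odd
  ones.
\<close>

lemma has_back_arc_iff_interleave:
  assumes "k \<ge> 1"
  shows "has_back_arc G a x y k \<longleftrightarrow>
    (\<exists>p<2 * a. interleave x y ((p + 2 * k - 1) mod (2 * a)) \<rightarrow>\<^bsub>G\<^esub> interleave x y p)"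
    (is "_ \<longleftrightarrow> (\<exists>p<_. ?jump p)")
proof -
  have "(2 * i + 2 * k - 1) div 2 = i + k - 1" "odd (2 * i + 2 * k - 1)" for i
    using assms by presburger+
  then have even: "?jump (2 * i) \<longleftrightarrow> y ((i + k - 1) mod a) \<rightarrow>\<^bsub>G\<^esub> x i" for i
    by (simp only: interleave_mod) (simp add: interleave_def)
  have "(2 * i + 1 + 2 * k - 1) div 2 = i + k" "even (2 * i + 1 + 2 * k - 1)" for i
    by presburger+
  then have odd: "?jump (2 * i + 1) \<longleftrightarrow> x ((i + k) mod a) \<rightarrow>\<^bsub>G\<^esub> y i" for i
    by (simp only: interleave_mod) (simp add: interleave_def)
  have "(\<exists>p<2 * a. ?jump p) \<longleftrightarrow> (\<exists>i<a. ?jump (2 * i) \<or> ?jump (2 * i + 1))"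
  proof
    assume "\<exists>p<2 * a. ?jump p"
    then obtain p where p: "p < 2 * a" "?jump p"
      by blast
    have "p = 2 * (p div 2) \<or> p = 2 * (p div 2) + 1" "p div 2 < a"
      using p(1) by presburger+
    with p(2) show "\<exists>i<a. ?jump (2 * i) \<or> ?jump (2 * i + 1)"
      by metis
  next
    assume "\<exists>i<a. ?jump (2 * i) \<or> ?jump (2 * i + 1)"
    then obtain i where "i < a" "?jump (2 * i) \<or> ?jump (2 * i + 1)"
      by blast
    moreover from this have "2 * i < 2 * a" "2 * i + 1 < 2 * a"
      by simp_all
    ultimately show "\<exists>p<2 * a. ?jump p"
      by blast
  qed
  then show ?thesis
    unfolding even odd has_back_arc_def by simp
qed

lemma (in balanced_bipartite_digraph) interleave_arc:
  assumes "hamiltonian_cycle (alternating_seq a x y)" "m < 2 * a"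
  shows "interleave x y m \<rightarrow> interleave x y (Suc m mod (2 * a))"
proof -
  let ?c = "alternating_seq a x y"
  \<comment> \<open>For a nonempty arc sequence the vertex sequence is independent of the start vertex given,
    so the cycle may be taken to start where its arcs do.\<close>
  from assms obtain u p where "cycle p" "awalk_verts u p = ?c"
    by (auto simp: hamiltonian_cycle_def)
  then obtain v where v: "awalk v p v" "p \<noteq> []"
    by (auto simp: cycle_def)
  then have "awalk_verts v p = ?c"
    using \<open>awalk_verts u p = ?c\<close> by (cases p) (auto)
  then have "set (vwalk_arcs ?c) \<subseteq> arcs_ends G"
    using vwalk_arcs_awalk_verts[OF v(1)] by simp
  moreover have "(?c ! m, ?c ! Suc m) \<in> set (vwalk_arcs ?c)"
    using assms by (intro nth_consecutive_in_vwalk_arcs) (simp add: alternating_seq_eq_interleave)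
  moreover have "?c ! m = interleave x y m" "?c ! Suc m = interleave x y (Suc m mod (2 * a))"
    using assms by (cases "Suc m = 2 * a"; simp add: alternating_seq_eq_interleave nth_append)+
  ultimately show ?thesis
    by auto
qed

section \<open>Hamiltonian cycles without Hamiltonian bypasses\<close>

theorem theorem4p1:
  fixes B :: "('v, 'e) pre_digraph"
    and X Y :: "'v set"
    and x y :: "nat \<Rightarrow> 'v"
    and a l k :: nat
  assumes B: "balanced_bipartite_digraph B X Y"
    and X: "bij_betw x {..<a} X"
    and Y: "bij_betw y {..<a} Y"
    and degrees: "\<And>u v. u \<in> X \<and> v \<in> Y \<or> u \<in> Y \<and> v \<in> X \<Longrightarrow> \<not> u \<rightarrow>\<^bsub>B\<^esub> v \<Longrightarrow>
      out_degree B u + in_degree B v \<ge> a + l"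
    and C: "pre_digraph.hamiltonian_cycle B (alternating_seq a x y)"
    and k_pos: "k \<ge> 1"
    and k_back: "has_back_arc B a x y k"
    and k_min: "\<And>j. j \<ge> 1 \<Longrightarrow> has_back_arc B a x y j \<Longrightarrow> k \<le> j"
    and no_bypass: "\<nexists>w. pre_digraph.hamiltonian_bypass B w"
  shows "l = 0 \<and> k = 2"
proof -
  interpret balanced_bipartite_digraph B X Y
    by (rule B)
  let ?v = "interleave x y"
  obtain s where s: "s < 2 * a" "?v ((s + 2 * k - 1) mod (2 * a)) \<rightarrow>\<^bsub>B\<^esub> ?v s"
    using k_back k_pos by (auto simp: has_back_arc_iff_interleave)
  then have a: "a \<ge> 1"
    by simp
  have in_X_iff: "?v p \<in> X \<longleftrightarrow> even p" and in_Y_iff: "?v p \<in> Y \<longleftrightarrow> odd p" if "p < 2 * a" for p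
  proof -
    have "p div 2 < a"
      using that by simp
    then have "x (p div 2) \<in> X" "y (p div 2) \<in> Y"
      using X Y by (auto dest: bij_betwE)
    then show "?v p \<in> X \<longleftrightarrow> even p" "?v p \<in> Y \<longleftrightarrow> odd p"
      using disjoint by (auto simp: interleave_def)
  qed
  have v_inj: "inj_on ?v {..<2 * a}"
  proof (rule inj_onI)
    fix p q assume pq: "p \<in> {..<2 * a}" "q \<in> {..<2 * a}" "?v p = ?v q"
    then have par: "even p \<longleftrightarrow> even q"
      using in_X_iff by (metis lessThan_iff)
    moreover have "p div 2 = q div 2"
      using pq par X Y by (auto simp: interleave_def bij_betw_def inj_on_def split: if_splits)
    ultimately show "p = q"
      by presburger
  qed
  have v_range: "?v ` {..<2 * a} = verts B"
  proof
    show "?v ` {..<2 * a} \<subseteq> verts B"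
      using in_X_iff in_Y_iff verts_eq by auto
    show "verts B \<subseteq> ?v ` {..<2 * a}"
    proof
      fix w assume "w \<in> verts B"
      then obtain i where "i < a" "w = x i \<or> w = y i"
        using X Y verts_eq by (auto simp: bij_betw_def)
      then have "w = ?v (2 * i) \<or> w = ?v (2 * i + 1)" "2 * i < 2 * a" "2 * i + 1 < 2 * a"
        by (auto simp: interleave_def)
      then show "w \<in> ?v ` {..<2 * a}"
        by blast
    qed
  qed
  \<comment> \<open>The cycle is rotated so that the shortest back arc ends at position 0.\<close>
  define z where "z m = ?v ((s + m) mod (2 * a))" for m
  have z_step: "z m \<rightarrow>\<^bsub>B\<^esub> z (Suc m)" for m
    using interleave_arc[OF C, of "(s + m) mod (2 * a)"] a by (simp add: z_def mod_Suc_eq)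
  have z_period: "z (m + 2 * a) = z m" for m
    by (simp add: z_def flip: add.assoc)
  have rot_inj: "inj_on (\<lambda>m. (s + m) mod (2 * a)) {..<2 * a}"
  proof (rule inj_onI)
    fix p q assume "p \<in> {..<2 * a}" "q \<in> {..<2 * a}" "(s + p) mod (2 * a) = (s + q) mod (2 * a)"
    then show "p = q"
      using s(1) by (auto simp: mod_if[of "_ + _"] split: if_splits)
  qed
  have rot_range: "(\<lambda>m. (s + m) mod (2 * a)) ` {..<2 * a} = {..<2 * a}"
    by (rule endo_inj_surj) (use a rot_inj in auto)
  interpret numbered_hamiltonian_cycle B z "2 * a"
  proof
    show "inj_on z {..<2 * a}"
      using comp_inj_on[OF rot_inj] v_inj rot_range by (simp add: z_def[abs_def] comp_def)
    show "z ` {..<2 * a} = verts B"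
      unfolding z_def[abs_def] using v_range rot_range
      by (metis image_image)
    show "z m \<rightarrow>\<^bsub>B\<^esub> z (Suc m)" for m
      by (rule z_step)
    show "z (2 * a - 1) \<rightarrow>\<^bsub>B\<^esub> z 0"
      using z_step[of "2 * a - 1"] z_period[of 0] a by simp
  qed
  have z_in_X_iff: "z m \<in> X \<longleftrightarrow> even (s + m)" and z_in_Y_iff: "z m \<in> Y \<longleftrightarrow> odd (s + m)" for m
  proof -
    have "(s + m) mod (2 * a) < 2 * a" "even ((s + m) mod (2 * a)) \<longleftrightarrow> even (s + m)"
      using a by (auto simp: dvd_mod_iff)
    then show "z m \<in> X \<longleftrightarrow> even (s + m)" "z m \<in> Y \<longleftrightarrow> odd (s + m)"
      using in_X_iff in_Y_iff unfolding z_def by auto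
  qed
  have parity: "odd (p + q)" if "z p \<rightarrow>\<^bsub>B\<^esub> z q" for p q
    using arcs_cross[OF that] unfolding z_in_X_iff z_in_Y_iff by auto
  have back_arc: "z (2 * k - 1) \<rightarrow>\<^bsub>B\<^esub> z 0"
    using s k_pos by (simp add: z_def)
  have short: "\<not> z (m + 2 * j - 1) \<rightarrow>\<^bsub>B\<^esub> z m" if "1 \<le> j" "j < k" for m j
  proof
    assume "z (m + 2 * j - 1) \<rightarrow>\<^bsub>B\<^esub> z m"
    moreover have "((s + m) mod (2 * a) + 2 * j - 1) mod (2 * a) = (s + (m + 2 * j - 1)) mod (2 * a)"
      using that mod_add_left_eq[of "s + m" "2 * a" "2 * j - 1"] by (simp add: add.assoc)
    ultimately have "has_back_arc B a x y j"
      unfolding has_back_arc_iff_interleave[OF \<open>1 \<le> j\<close>] using a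
      by (intro exI[of _ "(s + m) mod (2 * a)"]) (simp add: z_def)
    then show False
      using k_min that by fastforce
  qed
  have "k \<noteq> 1"
    using bypass_if_reversed_cycle_arc back_arc no_bypass a by auto
  then have k2: "2 \<le> k"
    using k_pos by simp
  \<comment> \<open>A jump back by \<open>2 * a - 1\<close> is a step forward along the cycle, so \<open>k\<close> is at most \<open>a\<close>.\<close>
  have "has_back_arc B a x y a"
    unfolding has_back_arc_iff_interleave[OF a]
    using a interleave_arc[OF C, of "2 * a - 1"]
    by (intro exI[of _ 0]) simp
  then have "k \<le> a"
    using k_min a by blast
  have "\<not> z (2 * k - 2) \<rightarrow>\<^bsub>B\<^esub> z 1"
    using short[of "k - 1" 1] k2 by (simp add: diff_mult_distrib2)
  moreover have "z (2 * k - 2) \<in> X \<and> z 1 \<in> Y \<or> z (2 * k - 2) \<in> Y \<and> z 1 \<in> X"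
    unfolding z_in_X_iff z_in_Y_iff by auto
  ultimately have "a + l \<le> out_degree B (z (2 * k - 2)) + in_degree B (z 1)"
    using degrees by blast
  moreover have "out_degree B (z (2 * k - 2)) + in_degree B (z 1) + k \<le> a + 2"
  proof (rule degree_sum_le)
    show "\<not> z (2 * k - 2) \<rightarrow>\<^bsub>B\<^esub> z (2 * m + 1)" if "m < k - 1" for m
    proof -
      have "2 * m + 1 + 2 * (k - 1 - m) - 1 = 2 * k - 2"
        using that by simp
      with short[of "k - 1 - m" "2 * m + 1"] that show ?thesis
        by simp
    qed
    show "\<not> z (2 * m) \<rightarrow>\<^bsub>B\<^esub> z 1" if "1 \<le> m" "m < k" for m
      using short[of m 1] that by simp
  qed (use k2 \<open>k \<le> a\<close> back_arc parity no_bypass in auto)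
  ultimately show ?thesis
    using k2 by simp
qed

end
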